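(* Let $\alpha>1$, $p\in[0,1]$, and let $Y_{2\alpha,\frac1\alpha}^{(p)}(t)=F_{2\alpha}^{(p)}(S_{\frac1\alpha}(t))$ be the asymmetric fractional Fresnel pseudoprocess time-changed with an independent stable subordinator of exponent $\frac1\alpha$. Then for every $t>0$ its distribution has the probability density function $$f(x)=\frac{t\cos\frac{\pi}{2\alpha}}{\pi}\left[\frac{p}{x^2+t^2-2xt\sin\frac{\pi}{2\alpha}}+\frac{1-p}{x^2+t^2+2xt\sin\frac{\pi}{2\alpha}}\right]=\frac{t\cos\frac{\pi}{2\alpha}}{\pi}\cdot\frac{x^2+t^2+2(2p-1)xt\sin\frac{\pi}{2\alpha}}{x^4+t^4+2x^2t^2\cos\frac{\pi}{\alpha}},\qquad x\in\mathbb{R}.$$ Moreover, if $$\alpha=\frac{\pi}{2\arccos\left(\frac{1}{\sqrt3}\right)}\qquad\text{and}\qquad p=\frac{\sqrt2\mp1}{2\sqrt2},$$ then (with corresponding choice of signs: upper signs together, lower signs together) $f$ has exactly two stationary points, one of which is an inflection point located at $x=\pm\frac{t}{\sqrt3}$ and the other of which is a maximum point.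
   Context: For real $\alpha>1$ the generalized Airy function is $\mathrm{Ai}_{\alpha}(x)=\frac{1}{\pi}\int_0^{+\infty}\cos\left(sx+\frac{s^{\alpha}}{\alpha}\right)ds$, $x\in\mathbb{R}$ (convergent improper Riemann integral). The pseudo-density (density of a signed measure) of the asymmetric fractional Fresnel pseudoprocess $F_{2\alpha}^{(p)}(t)$ is $$u_{2\alpha,p}(x,t)=\frac{1}{(\alpha t)^{1/\alpha}}\left[p\,\mathrm{Ai}_{\alpha}\left(-\frac{x}{(\alpha t)^{1/\alpha}}\right)+(1-p)\,\mathrm{Ai}_{\alpha}\left(\frac{x}{(\alpha t)^{1/\alpha}}\right)\right],\qquad x\in\mathbb{R},\ t>0.$$ The stable subordinator $S_\theta(t)$, $\theta\in(0,1)$, is the positive random variable with characteristic function $\mathbb{E}[e^{i\gamma S_{\theta}(t)}]=\exp\left(-t|\gamma|^{\theta}e^{-i\frac{\pi\theta}{2}\operatorname{sgn}\gamma}\right)$; let $h_\theta(s,t)$, $s>0$, be its probability density. The distribution of $F_{2\alpha}^{(p)}(S_\theta(t))$ is by definition the signed measure on $\mathbb{R}$ with density $x\mapsto\int_0^{+\infty}u_{2\alpha,p}(x,s)\,h_{\theta}(s,t)\,ds$. A stationary point is a zero of $f'$; a stationary inflection point is a zero of $f'$ at which $f''$ vanishes and $f'$ does not change sign. *)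

theory Defs
  imports "HOL-Probability.Probability"
begin

text \<open>The integral is not absolutely convergent, so it has to be read as an improper
  Riemann integral and not as a Lebesgue integral over the half-line.\<close>

definition gen_Airy :: "real \<Rightarrow> real \<Rightarrow> real" where
  "gen_Airy \<alpha> x =
     1 / pi * Lim at_top (\<lambda>R. integral {0..R} (\<lambda>s. cos (s * x + s powr \<alpha> / \<alpha>)))"

definition Fresnel_density :: "real \<Rightarrow> real \<Rightarrow> real \<Rightarrow> real \<Rightarrow> real" where
  "Fresnel_density \<alpha> p x t =
     1 / (\<alpha> * t) powr (1 / \<alpha>) *
       (p * gen_Airy \<alpha> (- (x / (\<alpha> * t) powr (1 / \<alpha>)))
        + (1 - p) * gen_Airy \<alpha> (x / (\<alpha> * t) powr (1 / \<alpha>)))"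

text \<open>The value at time \<open>t\<close> of a stable subordinator of exponent \<open>\<theta>\<close>: only the one-dimensional
  law matters here.\<close>

definition stable_subordinator_at ::
    "'w measure \<Rightarrow> real \<Rightarrow> real \<Rightarrow> ('w \<Rightarrow> real) \<Rightarrow> bool" where
  "stable_subordinator_at M \<theta> t S \<longleftrightarrow>
     prob_space M \<and> S \<in> borel_measurable M \<and> (AE w in M. 0 < S w) \<and>
     (\<forall>\<gamma>. char (distr M borel S) \<gamma> =
        exp (- of_real (t * \<bar>\<gamma>\<bar> powr \<theta>) * exp (- \<i> * of_real (pi * \<theta> / 2 * sgn \<gamma>))))"

text \<open>A density of a positive random variable is a function on the open half-line; the values of
  \<open>h\<close> on the nonpositive reals are irrelevant.\<close>

definition halfline_density :: "'w measure \<Rightarrow> ('w \<Rightarrow> real) \<Rightarrow> (real \<Rightarrow> real) \<Rightarrow> bool" where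
  "halfline_density M S h \<longleftrightarrow>
     (\<forall>s>0. 0 \<le> h s) \<and>
     distributed M lborel S (\<lambda>s. ennreal (h s) * indicator {0<..} s)"

definition subordinated_density ::
    "(real \<Rightarrow> real \<Rightarrow> real) \<Rightarrow> (real \<Rightarrow> real) \<Rightarrow> real \<Rightarrow> real" where
  "subordinated_density u h x = (LBINT s:{0<..}. u x s * h s)"

text \<open>The signed measure with density \<open>g\<close>, as a real-valued set function on the Borel sets.
  It is meaningful for Lebesgue integrable \<open>g\<close>.\<close>

definition signed_measure_of_density :: "(real \<Rightarrow> real) \<Rightarrow> real set \<Rightarrow> real" where
  "signed_measure_of_density g A = (LBINT x:A. g x)"

definition has_probability_density :: "(real set \<Rightarrow> real) \<Rightarrow> (real \<Rightarrow> real) \<Rightarrow> bool" where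
  "has_probability_density \<nu> f \<longleftrightarrow>
     (\<forall>x. 0 \<le> f x) \<and> has_bochner_integral lborel f 1 \<and>
     (\<forall>A\<in>sets borel. \<nu> A = (LBINT x:A. f x))"

definition stationary_point :: "(real \<Rightarrow> real) \<Rightarrow> real \<Rightarrow> bool" where
  "stationary_point f x \<longleftrightarrow> (f has_real_derivative 0) (at x)"

definition stationary_inflection_point :: "(real \<Rightarrow> real) \<Rightarrow> real \<Rightarrow> bool" where
  "stationary_inflection_point f x \<longleftrightarrow>
     stationary_point f x \<and>
     (\<forall>\<^sub>F y in nhds x. f differentiable (at y)) \<and>
     (deriv f has_real_derivative 0) (at x) \<and>
     ((\<forall>\<^sub>F y in at x. 0 \<le> deriv f y) \<or> (\<forall>\<^sub>F y in at x. deriv f y \<le> 0))"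

end

theory Submission
  imports Defs
begin

text \<open>After rescaling, the Fresnel density at time \<open>s\<close> is a combination of the improper integrals
  of \<open>cos (\<gamma> * x + s * \<gamma> powr \<alpha>)\<close> over the half-line. Since \<open>(\<gamma> powr \<alpha>) powr (1 / \<alpha>) = \<gamma>\<close>,
  averaging the integrand over \<open>s\<close> turns the characteristic function of the subordinator into
  an exponential that is linear in \<open>\<gamma>\<close>, and the resulting elementary integral is a Cauchy kernel.
  The exchange of limit and expectation is by dominated convergence: the partial integrals are
  bounded by a constant plus a negative power of \<open>s\<close> (cut at the point where the phase has
  derivative at least one), and a stable subordinator has negative moments of all orders, because
  its Laplace transform satisfies \<open>L (n powr (1 / \<theta>)) = L 1 ^ n\<close> with \<open>L 1 < 1\<close>.\<close>

section \<open>Truncated oscillatory integrals and their improper limit\<close>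

definition osc :: "real \<Rightarrow> real \<Rightarrow> real \<Rightarrow> real \<Rightarrow> real" where
  "osc \<alpha> x s R = integral {0..R} (\<lambda>\<gamma>. cos (\<gamma> * x + s * \<gamma> powr \<alpha>))"

lemma continuous_on_osc_integrand:
  assumes "\<alpha> > 0" "0 \<le> a"
  shows "continuous_on {a..b} (\<lambda>\<gamma>::real. cos (\<gamma> * x + s * \<gamma> powr \<alpha>))"
  using assms by (intro continuous_on_cos continuous_on_add continuous_on_mult continuous_on_powr'
      continuous_on_id continuous_on_const) auto

text \<open>First derivative (van der Corput) test: since \<alpha> > 1, the derivative of the phase
  increases, so it is smallest at \<open>a\<close>. The second mean value theorem, with its
  reciprocal as weight, leaves two integrals of the derivative of a sine, each at most 2. The bound
  is uniform in \<open>b\<close>, which serves both convergence and domination.\<close>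

lemma osc_increment_bound:
  fixes \<alpha> x s a b :: real
  assumes "\<alpha> > 1" "s > 0" "0 < a" "a \<le> b" and pos: "0 < x + s * \<alpha> * a powr (\<alpha> - 1)"
  shows "\<bar>integral {a..b} (\<lambda>\<gamma>. cos (\<gamma> * x + s * \<gamma> powr \<alpha>))\<bar>
           \<le> 4 / (x + s * \<alpha> * a powr (\<alpha> - 1))"
proof -
  define \<phi> where "\<phi> \<gamma> = \<gamma> * x + s * \<gamma> powr \<alpha>" for \<gamma>
  define \<psi> where "\<psi> \<gamma> = x + s * \<alpha> * \<gamma> powr (\<alpha> - 1)" for \<gamma>
  have \<psi>_mono: "\<psi> u \<le> \<psi> v" if "a \<le> u" "u \<le> v" for u v
    using that assms powr_mono2[of "\<alpha> - 1" u v] unfolding \<psi>_def by simp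
  have \<psi>_pos: "0 < \<psi> u" if "a \<le> u" for u
    using \<psi>_mono[of a u] that pos by (simp add: \<psi>_def)
  have deriv: "((\<lambda>\<gamma>. sin (\<phi> \<gamma>)) has_real_derivative \<psi> \<gamma> * cos (\<phi> \<gamma>)) (at \<gamma> within T)" if "a \<le> \<gamma>" for \<gamma> T
  proof -
    have "(\<phi> has_real_derivative \<psi> \<gamma>) (at \<gamma>)"
      using that assms(3) unfolding \<phi>_def \<psi>_def
      by (auto intro!: derivative_eq_intros has_real_derivative_powr)
    from DERIV_fun_sin[OF this] show ?thesis
      by (simp add: mult.commute has_field_derivative_at_within)
  qed
  have ftc: "((\<lambda>\<gamma>. \<psi> \<gamma> * cos (\<phi> \<gamma>)) has_integral (sin (\<phi> v) - sin (\<phi> u))) {u..v}"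
    if "a \<le> u" "u \<le> v" for u v
    by (rule fundamental_theorem_of_calculus[OF \<open>u \<le> v\<close>],
        unfold has_real_derivative_iff_has_vector_derivative[symmetric], rule deriv)
      (use that in simp)
  have sin_diff: "\<bar>integral {u..v} (\<lambda>\<gamma>. \<psi> \<gamma> * cos (\<phi> \<gamma>))\<bar> \<le> 2" if "a \<le> u" "u \<le> v" for u v
  proof -
    have "\<bar>sin (\<phi> v) - sin (\<phi> u)\<bar> \<le> 2"
      using sin_ge_minus_one[of "\<phi> v"] sin_le_one[of "\<phi> v"] sin_ge_minus_one[of "\<phi> u"] sin_le_one[of "\<phi> u"]
      by linarith
    then show ?thesis using integral_unique[OF ftc[OF that]] by simp
  qed
  \<comment> \<open>\<open>cos \<circ> \<phi>\<close> is the derivative of \<open>sin \<circ> \<phi>\<close> times the monotone factor \<open>1 / \<psi>\<close>.\<close>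
  obtain c where c: "c \<in> {a..b}"
    and eq: "integral {a..b} (\<lambda>\<gamma>. - (1 / \<psi> \<gamma>) * (\<psi> \<gamma> * cos (\<phi> \<gamma>)))
      = - (1 / \<psi> a) * integral {a..c} (\<lambda>\<gamma>. \<psi> \<gamma> * cos (\<phi> \<gamma>))
        + - (1 / \<psi> b) * integral {c..b} (\<lambda>\<gamma>. \<psi> \<gamma> * cos (\<phi> \<gamma>))"
  proof (rule second_mean_value_theorem)
    show "(\<lambda>\<gamma>. \<psi> \<gamma> * cos (\<phi> \<gamma>)) integrable_on {a..b}"
      using ftc[OF order_refl \<open>a \<le> b\<close>] by blast
    \<comment> \<open>The second mean value theorem takes a nondecreasing weight, which is why the
      decreasing \<open>1 / \<psi>\<close> enters with a minus sign.\<close>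
    show "- (1 / \<psi> u) \<le> - (1 / \<psi> v)" if "a \<le> u" "u \<le> v" "v \<le> b" for u v
      using that \<psi>_mono[of u v] \<psi>_pos[of u] by (simp add: frac_le)
  qed (use \<open>a \<le> b\<close> in auto)
  have "integral {a..b} (\<lambda>\<gamma>. - (1 / \<psi> \<gamma>) * (\<psi> \<gamma> * cos (\<phi> \<gamma>))) = integral {a..b} (\<lambda>\<gamma>. - cos (\<phi> \<gamma>))"
  proof (rule integral_cong)
    fix u assume "u \<in> {a..b}"
    then have "\<psi> u \<noteq> 0" using \<psi>_pos[of u] by auto
    then show "- (1 / \<psi> u) * (\<psi> u * cos (\<phi> u)) = - cos (\<phi> u)" by simp
  qed
  then have "integral {a..b} (\<lambda>\<gamma>. cos (\<phi> \<gamma>))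
      = 1 / \<psi> a * integral {a..c} (\<lambda>\<gamma>. \<psi> \<gamma> * cos (\<phi> \<gamma>))
        + 1 / \<psi> b * integral {c..b} (\<lambda>\<gamma>. \<psi> \<gamma> * cos (\<phi> \<gamma>))"
    using eq by simp
  also have "\<bar>\<dots>\<bar> \<le> 1 / \<psi> a * 2 + 1 / \<psi> a * 2"
  proof (intro order_trans[OF abs_triangle_ineq] add_mono)
    show "\<bar>1 / \<psi> a * integral {a..c} (\<lambda>\<gamma>. \<psi> \<gamma> * cos (\<phi> \<gamma>))\<bar> \<le> 1 / \<psi> a * 2"
      unfolding abs_mult using c \<psi>_pos[of a] sin_diff[of a c] by (intro mult_mono) auto
    show "\<bar>1 / \<psi> b * integral {c..b} (\<lambda>\<gamma>. \<psi> \<gamma> * cos (\<phi> \<gamma>))\<bar> \<le> 1 / \<psi> a * 2"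
      unfolding abs_mult using c \<psi>_pos[of a] \<psi>_pos[of b] \<psi>_mono[of a b] sin_diff[of c b]
      by (intro mult_mono) (auto simp: frac_le)
  qed
  finally show ?thesis unfolding \<phi>_def \<psi>_def by simp
qed

lemma osc_diff:
  assumes "\<alpha> > 0" "0 \<le> R" "R \<le> R'"
  shows "osc \<alpha> x s R' - osc \<alpha> x s R = integral {R..R'} (\<lambda>\<gamma>. cos (\<gamma> * x + s * \<gamma> powr \<alpha>))"
proof -
  have "(\<lambda>\<gamma>. cos (\<gamma> * x + s * \<gamma> powr \<alpha>)) integrable_on {0..R'}"
    using assms by (intro integrable_continuous_real continuous_on_osc_integrand) auto
  from Henstock_Kurzweil_Integration.integral_combine[OF assms(2,3) this]
  show ?thesis unfolding osc_def by simp
qed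

text \<open>Up to the cut \<open>A\<close> the integrand is at most 1 in absolute value and
  contributes at most \<open>A\<close>; beyond it the phase derivative is at least 1 and the
  contribution is at most 4. The result is uniform in \<open>R\<close> and blows up at
  \<open>s = 0\<close> only like a power of \<open>1 / s\<close>.\<close>

lemma osc_bound:
  assumes "\<alpha> > 1" "s > 0" "R \<ge> 0"
  shows "\<bar>osc \<alpha> x s R\<bar> \<le> ((1 + \<bar>x\<bar>) / (s * \<alpha>)) powr (1 / (\<alpha> - 1)) + 4"
proof -
  \<comment> \<open>\<open>A\<close> solves
    \<open>s * \<alpha> * A powr (\<alpha> - 1) = 1 + \<bar>x\<bar>\<close>, so the phase derivative
    there is \<open>x + 1 + \<bar>x\<bar>\<close>, at least 1 for either sign of
    \<open>x\<close>.\<close>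
  define A where "A = ((1 + \<bar>x\<bar>) / (s * \<alpha>)) powr (1 / (\<alpha> - 1))"
  have A: "A > 0" using assms by (auto simp: A_def)
  have "A powr (\<alpha> - 1) = (1 + \<bar>x\<bar>) / (s * \<alpha>)"
    using assms by (simp add: A_def powr_powr)
  then have \<psi>: "1 \<le> x + s * \<alpha> * A powr (\<alpha> - 1)"
    using assms by simp
  have short: "\<bar>osc \<alpha> x s r\<bar> \<le> r" if "r \<ge> 0" for r
  proof -
    have "norm (osc \<alpha> x s r) \<le> integral {0..r} (\<lambda>_. 1 :: real)"
      unfolding osc_def using assms
      by (intro integral_norm_bound_integral integrable_continuous_real continuous_on_osc_integrand) auto
    then show ?thesis using that by simp
  qed
  show ?thesis
  proof (cases "R \<le> A")
    case True
    then show ?thesis using short[of R] assms by (auto simp: A_def)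
  next
    case False
    have "\<bar>osc \<alpha> x s R - osc \<alpha> x s A\<bar> \<le> 4 / (x + s * \<alpha> * A powr (\<alpha> - 1))"
      using osc_diff[of \<alpha> A R x s] osc_increment_bound[of \<alpha> s A R x] assms A \<psi> False by simp
    also have "\<dots> \<le> 4" using \<psi> by (simp add: divide_le_eq)
    finally show ?thesis using short[of A] A by (auto simp: A_def)
  qed
qed

text \<open>Cauchy criterion: the phase derivative tends to infinity, so all increments beyond a far
  enough point are small.\<close>

lemma osc_convergent:
  assumes "\<alpha> > 1" "s > 0"
  shows "\<exists>L. (osc \<alpha> x s \<longlongrightarrow> L) at_top"
proof -
  have lim: "filterlim (\<lambda>a. x + s * \<alpha> * a powr (\<alpha> - 1)) at_top at_top"
    using assms by real_asymp
  have "cauchy_filter (filtermap (osc \<alpha> x s) at_top)"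
    unfolding cauchy_filter_metric_filtermap
  proof (intro allI impI)
    fix e :: real assume e: "e > 0"
    \<comment> \<open>The threshold \<open>16 / e\<close> makes every increment beyond
      \<open>a\<close> at most \<open>e / 4\<close>, so two of them add up to less than
      \<open>e\<close>.\<close>
    obtain a where a: "a > 0" "x + s * \<alpha> * a powr (\<alpha> - 1) \<ge> 16 / e"
    proof -
      have "eventually (\<lambda>a. x + s * \<alpha> * a powr (\<alpha> - 1) \<ge> 16 / e \<and> a > 0) at_top"
        using lim eventually_gt_at_top[of 0] unfolding filterlim_at_top by (intro eventually_conj) blast+
      then show ?thesis using that by (auto dest!: eventually_happens)
    qed
    have \<psi>: "x + s * \<alpha> * a powr (\<alpha> - 1) > 0"
      using a(2) e by (smt (verit) divide_pos_pos)
    have near: "\<bar>osc \<alpha> x s R - osc \<alpha> x s a\<bar> \<le> e / 4" if "R \<ge> a" for R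
    proof -
      have "\<bar>osc \<alpha> x s R - osc \<alpha> x s a\<bar> \<le> 4 / (x + s * \<alpha> * a powr (\<alpha> - 1))"
        using osc_diff[of \<alpha> a R x s] osc_increment_bound[of \<alpha> s a R x] assms a \<psi> that by simp
      also have "\<dots> \<le> 4 / (16 / e)" using a e by (intro frac_le) auto
      finally show ?thesis by simp
    qed
    show "\<exists>P. eventually P at_top \<and> (\<forall>R R'. P R \<and> P R' \<longrightarrow> dist (osc \<alpha> x s R) (osc \<alpha> x s R') < e)"
    proof (intro exI[of _ "\<lambda>R. R \<ge> a"] conjI allI impI eventually_ge_at_top)
      fix R R' assume "a \<le> R \<and> a \<le> R'"
      then show "dist (osc \<alpha> x s R) (osc \<alpha> x s R') < e"
        using near[of R] near[of R'] e unfolding dist_real_def by linarith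
    qed
  qed
  then obtain L where "filtermap (osc \<alpha> x s) at_top \<le> nhds L"
    using cauchy_filter_complete_converges[of "filtermap (osc \<alpha> x s) at_top" UNIV] complete_UNIV
      filtermap_bot_iff[of "osc \<alpha> x s" at_top] trivial_limit_at_top_linorder by auto
  then show ?thesis unfolding filterlim_def by blast
qed

definition osc_limit :: "real \<Rightarrow> real \<Rightarrow> real \<Rightarrow> real" where
  "osc_limit \<alpha> x s = Lim at_top (osc \<alpha> x s)"

lemma osc_tendsto:
  assumes "\<alpha> > 1" "s > 0"
  shows "(osc \<alpha> x s \<longlongrightarrow> osc_limit \<alpha> x s) at_top"
  using osc_convergent[OF assms] unfolding osc_limit_def
  by (metis tendsto_Lim trivial_limit_at_top_linorder)

text \<open>Substituting \<open>v = c * u\<close> turns \<open>v powr \<alpha> / \<alpha>\<close>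
  into \<open>s * u powr \<alpha>\<close>, because \<open>c powr \<alpha> = \<alpha> * s\<close>;
  the Jacobian \<open>c\<close> cancels the prefactor. Time then appears only as a coefficient in
  the phase, ready for averaging.\<close>

lemma gen_Airy_scaled:
  assumes "\<alpha> > 1" "s > 0" and c: "c = (\<alpha> * s) powr (1 / \<alpha>)"
  shows "1 / c * gen_Airy \<alpha> (x / c) = osc_limit \<alpha> x s / pi"
proof -
  have cpos: "c > 0" and c\<alpha>: "c powr \<alpha> = \<alpha> * s" using assms by (auto simp: c powr_powr)
  have *: "integral {0..R} (\<lambda>v. cos (v * (x / c) + v powr \<alpha> / \<alpha>)) = c * osc \<alpha> x s (R / c)"
    if "R \<ge> 0" for R
  proof -
    have "(\<lambda>u. u / c) ` {0..R} = {0..R / c}"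
      using cpos by (simp add: image_divide_atLeastAtMost)
    moreover have "integral {0..R/c} (\<lambda>u. cos (c * u * (x / c) + (c * u) powr \<alpha> / \<alpha>)) = osc \<alpha> x s (R / c)"
      unfolding osc_def
    proof (rule integral_cong)
      fix u assume "u \<in> {0..R / c}"
      then have "(c * u) powr \<alpha> / \<alpha> = s * u powr \<alpha>"
        using cpos assms(1,2) by (simp add: powr_mult c\<alpha>)
      then show "cos (c * u * (x / c) + (c * u) powr \<alpha> / \<alpha>) = cos (u * x + s * u powr \<alpha>)"
        using cpos by simp
    qed
    ultimately show ?thesis
      using integral_stretch_real[of c 0 R "\<lambda>v. cos (v * (x / c) + v powr \<alpha> / \<alpha>)"] cpos
      by (simp add: field_simps)
  qed
  have "filterlim (\<lambda>R. R / c) at_top at_top"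
    using cpos by real_asymp
  from tendsto_mult[OF tendsto_const[of c] filterlim_compose[OF osc_tendsto[OF assms(1,2), of x] this]]
  have "((\<lambda>R. integral {0..R} (\<lambda>v. cos (v * (x / c) + v powr \<alpha> / \<alpha>))) \<longlongrightarrow> c * osc_limit \<alpha> x s) at_top"
    by (rule Lim_transform_eventually) (intro eventually_mono[OF eventually_ge_at_top[of 0]] *[symmetric])
  then have "Lim at_top (\<lambda>R. integral {0..R} (\<lambda>v. cos (v * (x / c) + v powr \<alpha> / \<alpha>))) = c * osc_limit \<alpha> x s"
    by (intro tendsto_Lim) auto
  then show ?thesis using cpos unfolding gen_Airy_def by simp
qed

lemma Fresnel_density_eq_osc_limit:
  assumes "\<alpha> > 1" "s > 0"
  shows "Fresnel_density \<alpha> p x s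
    = p / pi * osc_limit \<alpha> (- x) s + (1 - p) / pi * osc_limit \<alpha> x s"
proof -
  define c where "c = (\<alpha> * s) powr (1 / \<alpha>)"
  have "Fresnel_density \<alpha> p x s
    = p * (1 / c * gen_Airy \<alpha> (- x / c)) + (1 - p) * (1 / c * gen_Airy \<alpha> (x / c))"
    unfolding Fresnel_density_def c_def by (simp add: algebra_simps add_divide_distrib diff_divide_distrib)
  then show ?thesis unfolding gen_Airy_scaled[OF assms c_def] by (simp add: algebra_simps)
qed

section \<open>Negative moments of a stable law\<close>

text \<open>The characteristic exponent is homogeneous of degree \<theta>, so multiplying it by
  \<open>n\<close> amounts to scaling the variable by \<open>n powr (1 / \<theta>)\<close>. Levy
  uniqueness turns this into an equality of laws, and integrating \<open>exp (- y)\<close> against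
  both sides carries it over to the Laplace transform.\<close>

lemma Laplace_stable_power:
  fixes \<mu> :: "real measure"
  assumes \<mu>: "real_distribution \<mu>" and \<mu>_pos: "AE x in \<mu>. 0 < x" and \<theta>: "\<theta> > 0"
    and char: "\<And>\<gamma>. char \<mu> \<gamma> =
      exp (- of_real (t * \<bar>\<gamma>\<bar> powr \<theta>) * exp (- \<i> * of_real (pi * \<theta> / 2 * sgn \<gamma>)))"
  shows "(\<integral>x. exp (- (real n powr (1 / \<theta>) * x)) \<partial>\<mu>) = (\<integral>x. exp (- x) \<partial>\<mu>) ^ n"
proof -
  interpret real_distribution \<mu> by fact
  define c where "c = real n powr (1 / \<theta>)"
  interpret P: prob_space "PiM {..<n} (\<lambda>_. \<mu>)" by (rule prob_space_PiM) unfold_locales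
  interpret product_sigma_finite "\<lambda>_::nat. \<mu>" by unfold_locales
  define T where "T \<omega> = (\<Sum>i<n. \<omega> i)" for \<omega> :: "nat \<Rightarrow> real"
  have T[measurable]: "T \<in> borel_measurable (PiM {..<n} (\<lambda>_. \<mu>))"
    unfolding T_def by (intro borel_measurable_sum measurable_compose[OF measurable_component_singleton]) auto
  \<comment> \<open>strict stability: a sum of \<open>n\<close> independent copies is a rescaled copy\<close>
  have "distr (PiM {..<n} (\<lambda>_. \<mu>)) borel T = distr \<mu> borel (\<lambda>x. c * x)"
  proof (rule Levy_uniqueness)
    show "real_distribution (distr (PiM {..<n} (\<lambda>_. \<mu>)) borel T)"
      by (rule P.real_distribution_distr) simp
    show "real_distribution (distr \<mu> borel (\<lambda>x. c * x))"
      by (rule real_distribution_distr) simp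
    show "char (distr (PiM {..<n} (\<lambda>_. \<mu>)) borel T) = char (distr \<mu> borel (\<lambda>x. c * x))"
    proof
      fix \<gamma>
      have "char (distr (PiM {..<n} (\<lambda>_. \<mu>)) borel T) \<gamma>
          = (\<integral>\<omega>. (\<Prod>i<n. iexp (\<gamma> * \<omega> i)) \<partial>PiM {..<n} (\<lambda>_. \<mu>))"
        unfolding char_def
        by (subst integral_distr) (auto simp: T_def sum_distrib_left exp_sum intro!: Bochner_Integration.integral_cong)
      also have "\<dots> = char \<mu> \<gamma> ^ n"
        by (subst product_integral_prod) (auto simp: char_def integrable_iexp)
      also have "\<dots> = exp (of_nat n * (- of_real (t * \<bar>\<gamma>\<bar> powr \<theta>) * exp (- \<i> * of_real (pi * \<theta> / 2 * sgn \<gamma>))))"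
        by (simp only: char exp_of_nat_mult)
      \<comment> \<open>For \<open>n > 0\<close> the factor \<open>c\<close> is positive, so the
        sign is kept and \<open>\<bar>c * \<gamma>\<bar> powr \<theta>\<close> equals
        \<open>n * \<bar>\<gamma>\<bar> powr \<theta>\<close>; for \<open>n = 0\<close> both
        exponents vanish, as \<open>0 powr _\<close> is 0.\<close>
      also have "\<dots> = exp (- of_real (t * \<bar>c * \<gamma>\<bar> powr \<theta>) * exp (- \<i> * of_real (pi * \<theta> / 2 * sgn (c * \<gamma>))))"
        using \<theta> by (cases "n = 0") (auto simp: c_def abs_mult powr_mult powr_powr sgn_mult algebra_simps)
      also have "\<dots> = char (distr \<mu> borel (\<lambda>x. c * x)) \<gamma>"
        unfolding char[symmetric] unfolding char_def
        by (subst integral_distr) (auto simp: mult_ac)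
      finally show "char (distr (PiM {..<n} (\<lambda>_. \<mu>)) borel T) \<gamma> = char (distr \<mu> borel (\<lambda>x. c * x)) \<gamma>" .
    qed
  qed
  then have "(\<integral>y. exp (- y) \<partial>distr \<mu> borel (\<lambda>x. c * x)) = (\<integral>y. exp (- y) \<partial>distr (PiM {..<n} (\<lambda>_. \<mu>)) borel T)"
    by simp
  also have "\<dots> = (\<integral>\<omega>. (\<Prod>i<n. exp (- \<omega> i)) \<partial>PiM {..<n} (\<lambda>_. \<mu>))"
    by (subst integral_distr) (auto simp: T_def sum_negf[symmetric] exp_sum intro!: Bochner_Integration.integral_cong)
  also have "\<dots> = (\<integral>x. exp (- x) \<partial>\<mu>) ^ n"
  proof (subst product_integral_prod)
    show "integrable \<mu> (\<lambda>x. exp (- x))"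
      using \<mu>_pos by (intro integrable_const_bound[where B = 1]) (auto elim: eventually_mono)
  qed auto
  also have "(\<integral>y. exp (- y) \<partial>distr \<mu> borel (\<lambda>x. c * x)) = (\<integral>x. exp (- (c * x)) \<partial>\<mu>)"
    by (subst integral_distr) auto
  finally show ?thesis unfolding c_def .
qed

lemma summable_power_times_geometric:
  fixes q :: real
  assumes "0 < q" "q < 1"
  shows "summable (\<lambda>n. (real n + 1) ^ m * q ^ n)"
proof (rule summable_comparison_test_bigo)
  show "summable (\<lambda>n. norm (1 / real n ^ 2))"
    using inverse_power_summable[of 2, where 'a=real] by (simp add: inverse_eq_divide)
  show "(\<lambda>n. (real n + 1) ^ m * q ^ n) \<in> O(\<lambda>n. 1 / real n ^ 2)"
    using assms by real_asymp
qed

text \<open>The singular function is dominated by a series of exponentials: at each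
  \<open>x > 0\<close> a single term already suffices, the one with index the floor of
  \<open>x powr (- \<theta>)\<close>. The Laplace identity makes the expectations of the terms a
  polynomial times \<open>q ^ n\<close>, which is summable as \<open>q < 1\<close>.\<close>

lemma stable_negative_moment:
  fixes \<mu> :: "real measure"
  assumes \<mu>: "real_distribution \<mu>" and \<mu>_pos: "AE x in \<mu>. 0 < x" and \<theta>: "\<theta> > 0" and k: "k > 0"
    and char: "\<And>\<gamma>. char \<mu> \<gamma> =
      exp (- of_real (t * \<bar>\<gamma>\<bar> powr \<theta>) * exp (- \<i> * of_real (pi * \<theta> / 2 * sgn \<gamma>)))"
  shows "integrable \<mu> (\<lambda>x. x powr (- k))"
proof (rule integrableI_nonneg)
  interpret real_distribution \<mu> by fact
  show "(\<lambda>x. x powr (- k)) \<in> borel_measurable \<mu>" by simp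
  show "AE x in \<mu>. 0 \<le> x powr (- k)" by simp
  have int: "integrable \<mu> (\<lambda>x. exp (- (c * x)))" if "c \<ge> 0" for c
    using \<mu>_pos that by (intro integrable_const_bound[where B = 1]) (auto elim: eventually_mono)
  define q where "q = (\<integral>x. exp (- x) \<partial>\<mu>)"
  have int1: "integrable \<mu> (\<lambda>x. exp (- x))" using int[of 1] by simp
  have "q \<noteq> 0"
  proof
    assume "q = 0"
    then have "AE x in \<mu>. exp (- x) = (0::real)"
      unfolding q_def using integral_nonneg_eq_0_iff_AE[OF int1] by simp
    then show False using AE_const[of False] by simp
  qed
  moreover have "q \<ge> 0" unfolding q_def by simp
  ultimately have "q > 0" by simp
  \<comment> \<open>If \<open>q\<close> were 1, then \<open>exp (- x) = 1\<close>, that is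
    \<open>x = 0\<close>, would hold almost everywhere, against positivity.\<close>
  have "q < 1"
  proof -
    have le: "AE x in \<mu>. 0 \<le> 1 - exp (- x :: real)"
      using \<mu>_pos by (auto elim: eventually_mono)
    have int2: "integrable \<mu> (\<lambda>x. 1 - exp (- x))" using int1 by simp
    have eq: "(\<integral>x. 1 - exp (- x) \<partial>\<mu>) = 1 - q"
      unfolding q_def using int1 prob_space by simp
    have "1 - q \<noteq> 0"
    proof
      assume "1 - q = 0"
      then have "AE x in \<mu>. 1 - exp (- x) = (0::real)"
        using integral_nonneg_eq_0_iff_AE[OF int2 le] eq by simp
      with \<mu>_pos have "AE x in \<mu>. False" by eventually_elim simp
      then show False by simp
    qed
    moreover have "1 - q \<ge> 0" using integral_nonneg_AE[OF le] eq by simp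
    ultimately show ?thesis by simp
  qed
  obtain m :: nat where m: "k / \<theta> \<le> real m" using real_arch_simple by blast
  \<comment> \<open>The extra 1 in the exponent makes the exponential factor at least 1 whenever
    \<open>real n powr (1 / \<theta>) * x \<le> 1\<close>, while the polynomial factor dominates
    \<open>x powr (- k)\<close> as long as \<open>x powr (- \<theta>) \<le> real n + 1\<close>. Both
    hold for the \<open>N\<close> chosen below.\<close>
  define F where "F n x = (real n + 1) ^ m * exp (1 - real n powr (1 / \<theta>) * x)" for n x
  have bound: "ennreal (x powr (- k)) \<le> (\<Sum>n. ennreal (F n x))" if x: "x > 0" for x
  proof -
    define N where "N = nat \<lfloor>x powr (- \<theta>)\<rfloor>"
    have N: "real N \<le> x powr (- \<theta>)" "x powr (- \<theta>) \<le> real N + 1"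
      unfolding N_def by (auto simp: of_nat_floor)
    have "real N powr (1 / \<theta>) \<le> (x powr (- \<theta>)) powr (1 / \<theta>)"
      using N \<theta> by (intro powr_mono2) auto
    also have "\<dots> = 1 / x" using x \<theta> by (simp only: powr_powr) (simp add: powr_minus_divide)
    finally have "real N powr (1 / \<theta>) * x \<le> 1" using x by (simp add: field_simps)
    then have exp: "exp (1 - real N powr (1 / \<theta>) * x) \<ge> 1" by simp
    have "x powr (- k) = (x powr (- \<theta>)) powr (k / \<theta>)"
      using \<theta> by (simp add: powr_powr)
    also have "\<dots> \<le> (real N + 1) powr (k / \<theta>)"
      using N \<theta> k by (intro powr_mono2) auto
    also have "\<dots> \<le> (real N + 1) powr real m"
      using m by (intro powr_mono) auto
    also have "\<dots> = (real N + 1) ^ m" by (simp add: powr_realpow)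
    also have "\<dots> \<le> F N x" unfolding F_def using exp by (intro mult_le_cancel_left1[THEN iffD2]) auto
    finally have "ennreal (x powr (- k)) \<le> ennreal (F N x)" by (rule ennreal_leI)
    also have "\<dots> \<le> (\<Sum>n. ennreal (F n x))"
      using sum_le_suminf[of "\<lambda>n. ennreal (F n x)" "{N}"] by simp
    finally show ?thesis .
  qed
  have F: "(\<integral>\<^sup>+x. ennreal (F n x) \<partial>\<mu>) = ennreal (exp 1 * ((real n + 1) ^ m * q ^ n))" for n
  proof -
    have F_eq: "F n x = exp 1 * (real n + 1) ^ m * exp (- (real n powr (1 / \<theta>) * x))" for x
      by (simp add: F_def exp_diff exp_minus field_simps)
    have "(\<integral>\<^sup>+x. ennreal (F n x) \<partial>\<mu>) = ennreal (\<integral>x. F n x \<partial>\<mu>)"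
      unfolding F_eq by (intro nn_integral_eq_integral integrable_mult_right int) auto
    also have "(\<integral>x. F n x \<partial>\<mu>) = exp 1 * (real n + 1) ^ m * q ^ n"
      unfolding F_eq q_def Laplace_stable_power[OF \<mu> \<mu>_pos \<theta> char, symmetric] by simp
    finally show ?thesis by (simp add: mult.assoc)
  qed
  have "(\<integral>\<^sup>+x. ennreal (x powr (- k)) \<partial>\<mu>) \<le> (\<integral>\<^sup>+x. (\<Sum>n. ennreal (F n x)) \<partial>\<mu>)"
    using \<mu>_pos by (intro nn_integral_mono_AE) (auto elim!: eventually_mono intro: bound)
  also have "\<dots> = (\<Sum>n. \<integral>\<^sup>+x. ennreal (F n x) \<partial>\<mu>)"
    unfolding F_def by (intro nn_integral_suminf) measurable
  also have "\<dots> = (\<Sum>n. ennreal (exp 1 * ((real n + 1) ^ m * q ^ n)))"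
    unfolding F ..
  also have "\<dots> = ennreal (\<Sum>n. exp 1 * ((real n + 1) ^ m * q ^ n))"
    using \<open>0 < q\<close> \<open>q < 1\<close> by (intro suminf_ennreal2 summable_mult summable_power_times_geometric) auto
  also have "\<dots> < \<infinity>" by simp
  finally show "(\<integral>\<^sup>+x. ennreal (x powr (- k)) \<partial>\<mu>) < \<infinity>" .
qed

section \<open>Averaging over the subordinator and the Cauchy kernel\<close>

text \<open>The Lebesgue form on a bounded interval gives access to Fubini and to measurability in
  \<open>s\<close>.\<close>

lemma osc_eq_LBINT:
  assumes "\<alpha> > 0"
  shows "osc \<alpha> x s R = (\<integral>\<gamma>. indicator {0..R} \<gamma> * cos (\<gamma> * x + s * \<gamma> powr \<alpha>) \<partial>lborel)"
proof -
  have "set_integrable lborel {0..R} (\<lambda>\<gamma>. cos (\<gamma> * x + s * \<gamma> powr \<alpha>))"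
    using assms by (intro borel_integrable_atLeastAtMost' continuous_on_osc_integrand) auto
  from set_borel_integral_eq_integral(2)[OF this] show ?thesis
    unfolding osc_def set_lebesgue_integral_def by simp
qed

lemma expectation_osc:
  fixes \<mu> :: "real measure"
  assumes \<mu>: "real_distribution \<mu>" and "\<alpha> > 0"
    and char: "\<And>\<gamma>. char \<mu> \<gamma> =
      exp (- of_real (t * \<bar>\<gamma>\<bar> powr (1 / \<alpha>)) * exp (- \<i> * of_real (pi * (1 / \<alpha>) / 2 * sgn \<gamma>)))"
    and z: "z = \<i> * of_real x - of_real t * exp (- \<i> * of_real (pi / (2 * \<alpha>)))"
  shows "(\<integral>s. osc \<alpha> x s R \<partial>\<mu>) = integral {0..R} (\<lambda>\<gamma>. Re (exp (of_real \<gamma> * z)))"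
proof -
  interpret real_distribution \<mu> by fact
  interpret pair_sigma_finite lborel \<mu> by unfold_locales
  have sigma_finite: "sigma_finite_measure \<mu>" by unfold_locales
  define g where "g \<gamma> s = indicator {0..R} \<gamma> * cos (\<gamma> * x + s * \<gamma> powr \<alpha>)" for \<gamma> s :: real
  \<comment> \<open>The strip over \<open>{0..R}\<close> has finite product measure, and
    \<open>g\<close> is bounded there by 1.\<close>
  have g_int: "integrable (lborel \<Otimes>\<^sub>M \<mu>) (\<lambda>(\<gamma>, s). g \<gamma> s)"
  proof (rule Bochner_Integration.integrable_bound)
    have "emeasure (lborel \<Otimes>\<^sub>M \<mu>) ({0..R} \<times> space \<mu>) = emeasure lborel {0..R} * emeasure \<mu> (space \<mu>)"
      by (rule sigma_finite_measure.emeasure_pair_measure_Times[OF sigma_finite]) auto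
    also have "\<dots> < \<infinity>" using emeasure_space_1 by (simp add: emeasure_lborel_Icc_eq)
    finally show "integrable (lborel \<Otimes>\<^sub>M \<mu>) (indicator ({0..R} \<times> space \<mu>) :: _ \<Rightarrow> real)"
      by (intro integrable_real_indicator) auto
    show "(\<lambda>(\<gamma>, s). g \<gamma> s) \<in> borel_measurable (lborel \<Otimes>\<^sub>M \<mu>)"
      unfolding g_def by measurable
    show "AE p in lborel \<Otimes>\<^sub>M \<mu>. norm (case p of (\<gamma>, s) \<Rightarrow> g \<gamma> s) \<le> norm (indicator ({0..R} \<times> space \<mu>) p :: real)"
      by (rule AE_I2) (auto simp: g_def indicator_def)
  qed
  have inner: "(\<integral>s. cos (\<gamma> * x + s * \<gamma> powr \<alpha>) \<partial>\<mu>) = Re (exp (of_real \<gamma> * z))" if "\<gamma> \<ge> 0" for \<gamma>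
  proof -
    have "(\<integral>s. cos (\<gamma> * x + s * \<gamma> powr \<alpha>) \<partial>\<mu>) = (\<integral>s. Re (iexp (\<gamma> * x) * iexp (\<gamma> powr \<alpha> * s)) \<partial>\<mu>)"
      by (intro Bochner_Integration.integral_cong) (auto simp: exp_add[symmetric] Re_exp algebra_simps)
    also have "\<dots> = Re (\<integral>s. iexp (\<gamma> * x) * iexp (\<gamma> powr \<alpha> * s) \<partial>\<mu>)"
      by (intro integral_Re integrable_mult_right integrable_iexp) auto
    also have "\<dots> = Re (iexp (\<gamma> * x) * char \<mu> (\<gamma> powr \<alpha>))"
      by (simp add: char_def)
    \<comment> \<open>Here \<open>(\<gamma> powr \<alpha>) powr (1 / \<alpha>) = \<gamma>\<close>
      makes the exponent linear. The case \<open>\<gamma> = 0\<close> is separate because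
      \<open>sgn\<close> vanishes there; both sides are then 1.\<close>
    also have "iexp (\<gamma> * x) * char \<mu> (\<gamma> powr \<alpha>) = exp (of_real \<gamma> * z)"
      using that \<open>\<alpha> > 0\<close> unfolding char z
      by (cases "\<gamma> = 0") (auto simp: powr_powr exp_add[symmetric] algebra_simps)
    finally show ?thesis .
  qed
  have "(\<integral>s. osc \<alpha> x s R \<partial>\<mu>) = (\<integral>s. (\<integral>\<gamma>. g \<gamma> s \<partial>lborel) \<partial>\<mu>)"
    unfolding osc_eq_LBINT[OF \<open>\<alpha> > 0\<close>] g_def ..
  also have "\<dots> = (\<integral>\<gamma>. (\<integral>s. g \<gamma> s \<partial>\<mu>) \<partial>lborel)"
    by (rule Fubini_integral[OF g_int])
  also have "\<dots> = (LBINT \<gamma>:{0..R}. Re (exp (of_real \<gamma> * z)))"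
    unfolding g_def set_lebesgue_integral_def
    by (intro Bochner_Integration.integral_cong) (auto simp: inner indicator_def)
  also have "\<dots> = integral {0..R} (\<lambda>\<gamma>. Re (exp (of_real \<gamma> * z)))"
    by (intro set_borel_integral_eq_integral(2) borel_integrable_atLeastAtMost' continuous_intros)
  finally show ?thesis .
qed

lemma integral_Re_exp_tendsto:
  assumes "Re z < 0"
  shows "((\<lambda>R. integral {0..R} (\<lambda>\<gamma>. Re (exp (of_real \<gamma> * z)))) \<longlongrightarrow> Re (- 1 / z)) at_top"
proof -
  have z: "z \<noteq> 0" using assms by auto
  have "integral {0..R} (\<lambda>\<gamma>. Re (exp (of_real \<gamma> * z))) = Re ((exp (of_real R * z) - 1) / z)"
    if "R \<ge> 0" for R
  proof (rule integral_unique)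
    have "((\<lambda>\<gamma>. exp (of_real \<gamma> * z)) has_integral (exp (of_real R * z) / z - exp (of_real 0 * z) / z)) {0..R}"
    proof (rule fundamental_theorem_of_calculus[OF that])
      fix \<gamma> :: real
      show "((\<lambda>\<gamma>. exp (of_real \<gamma> * z) / z) has_vector_derivative exp (of_real \<gamma> * z)) (at \<gamma> within {0..R})"
        using z by (auto intro!: derivative_eq_intros has_vector_derivative_real_field)
    qed
    from has_integral_Re[OF this]
    show "((\<lambda>\<gamma>. Re (exp (of_real \<gamma> * z))) has_integral Re ((exp (of_real R * z) - 1) / z)) {0..R}"
      by (simp add: diff_divide_distrib)
  qed
  moreover have "((\<lambda>R. Re ((exp (of_real R * z) - 1) / z)) \<longlongrightarrow> Re ((0 - 1) / z)) at_top"
  proof (intro tendsto_intros z)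
    have "((\<lambda>R. exp (R * Re z)) \<longlongrightarrow> 0) at_top" using assms by real_asymp
    then show "((\<lambda>R. exp (of_real R * z)) \<longlongrightarrow> 0) at_top"
      by (subst tendsto_norm_zero_iff[symmetric]) (simp add: norm_exp_eq_Re)
  qed
  ultimately show ?thesis
    using filterlim_cong[OF refl refl eventually_mono[OF eventually_ge_at_top[of 0]],
        of "\<lambda>R. integral {0..R} (\<lambda>\<gamma>. Re (exp (of_real \<gamma> * z)))" "\<lambda>R. Re ((exp (of_real R * z) - 1) / z)"]
    by simp
qed

text \<open>The real part of \<open>- 1 / z\<close> is \<open>- Re z\<close> over the squared
  modulus: \<pi> times the Cauchy density with scale \<open>t * cos \<phi>\<close> centred at
  \<open>- t * sin \<phi>\<close>, when that scale is positive.\<close>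

lemma Cauchy_kernel_eq:
  assumes z: "z = \<i> * of_real x - of_real t * exp (- \<i> * of_real \<phi>)"
  shows "Re (- 1 / z) = t * cos \<phi> / (x\<^sup>2 + t\<^sup>2 + 2 * x * t * sin \<phi>)"
proof -
  have re: "Re z = - t * cos \<phi>" and im: "Im z = x + t * sin \<phi>"
    by (auto simp: z Re_exp Im_exp)
  have "(- t * cos \<phi>)\<^sup>2 + (x + t * sin \<phi>)\<^sup>2 = x\<^sup>2 + t\<^sup>2 * ((sin \<phi>)\<^sup>2 + (cos \<phi>)\<^sup>2) + 2 * x * t * sin \<phi>"
    by algebra
  then have "(Re z)\<^sup>2 + (Im z)\<^sup>2 = x\<^sup>2 + t\<^sup>2 + 2 * x * t * sin \<phi>"
    unfolding re im by simp
  then show ?thesis by (simp add: Re_divide re)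
qed

lemma osc_limit_expectation:
  fixes \<mu> :: "real measure"
  assumes \<mu>: "real_distribution \<mu>" and \<mu>_pos: "AE s in \<mu>. 0 < s" and \<alpha>: "\<alpha> > 1" and t: "t > 0"
    and char: "\<And>\<gamma>. char \<mu> \<gamma> =
      exp (- of_real (t * \<bar>\<gamma>\<bar> powr (1 / \<alpha>)) * exp (- \<i> * of_real (pi * (1 / \<alpha>) / 2 * sgn \<gamma>)))"
  shows "has_bochner_integral \<mu> (\<lambda>s. indicator {0<..} s * osc_limit \<alpha> x s)
    (t * cos (pi / (2 * \<alpha>)) / (x\<^sup>2 + t\<^sup>2 + 2 * x * t * sin (pi / (2 * \<alpha>))))"
proof -
  interpret real_distribution \<mu> by fact
  define z where "z = \<i> * of_real x - of_real t * exp (- \<i> * of_real (pi / (2 * \<alpha>)))"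
  define \<beta> where "\<beta> = 1 / (\<alpha> - 1)"
  have \<beta>: "\<beta> > 0" using \<alpha> by (simp add: \<beta>_def)
  \<comment> \<open>This is the bound of \<open>osc_bound\<close> with its dependence on
    \<open>s\<close> factored out; it is integrable by the negative moment of order \<beta>.\<close>
  define w where "w s = ((1 + \<bar>x\<bar>) / \<alpha>) powr \<beta> * s powr (- \<beta>) + 4" for s
  \<comment> \<open>Convergence of \<open>osc\<close> is known for \<open>s > 0\<close> only. The
    indicator makes the sequence converge everywhere, so the limit is Borel as a pointwise limit,
    and the expectations do not change.\<close>
  let ?f = "\<lambda>s. indicator {0<..} s * osc_limit \<alpha> x s"
  let ?g = "\<lambda>(n::nat) s. indicator {0<..} s * osc \<alpha> x s (real n)"
  have osc_meas[measurable]: "(\<lambda>s. osc \<alpha> x s R) \<in> borel_measurable borel" for R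
    unfolding osc_eq_LBINT[OF order_less_trans[OF zero_less_one \<alpha>]] by measurable
  have conv: "(\<lambda>n. ?g n s) \<longlonglongrightarrow> ?f s" for s
  proof (cases "s > 0")
    case True
    from tendsto_mult[OF tendsto_const filterlim_compose[OF osc_tendsto[OF \<alpha> True] filterlim_real_sequentially]]
    show ?thesis .
  qed auto
  have meas: "?g n \<in> borel_measurable borel" for n by measurable
  have f_meas: "?f \<in> borel_measurable borel"
    by (rule borel_measurable_LIMSEQ_real[OF conv meas])
  have w_int: "integrable \<mu> w"
    unfolding w_def using stable_negative_moment[OF \<mu> \<mu>_pos _ \<beta>, of "1 / \<alpha>" t] char \<alpha> by simp
  have bound: "AE s in \<mu>. norm (?g n s) \<le> w s" for n
    using \<mu>_pos
  proof eventually_elim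
    case (elim s)
    have "\<bar>osc \<alpha> x s n\<bar> \<le> ((1 + \<bar>x\<bar>) / (s * \<alpha>)) powr \<beta> + 4"
      using osc_bound[OF \<alpha> elim, of "real n" x] by (simp add: \<beta>_def)
    also have "((1 + \<bar>x\<bar>) / (s * \<alpha>)) powr \<beta> = ((1 + \<bar>x\<bar>) / \<alpha>) powr \<beta> * s powr (- \<beta>)"
      using elim \<alpha> by (simp add: powr_divide powr_mult powr_minus field_simps)
    finally show ?case using elim by (simp add: w_def)
  qed
  have "AE s in \<mu>. (\<lambda>n. ?g n s) \<longlonglongrightarrow> ?f s" using conv by simp
  have 1: "integrable \<mu> ?f"
    by (rule integrable_dominated_convergence[OF _ _ w_int AE_I2[OF conv] bound])
       (use f_meas meas in \<open>auto simp del: indicator_simps\<close>)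
  have 2: "(\<lambda>n. integral\<^sup>L \<mu> (?g n)) \<longlonglongrightarrow> integral\<^sup>L \<mu> ?f"
    by (rule integral_dominated_convergence[OF _ _ w_int AE_I2[OF conv] bound])
       (use f_meas meas in \<open>auto simp del: indicator_simps\<close>)
  have "integral\<^sup>L \<mu> (?g n) = integral {0..real n} (\<lambda>\<gamma>. Re (exp (of_real \<gamma> * z)))" for n
  proof -
    have "integral\<^sup>L \<mu> (?g n) = (\<integral>s. osc \<alpha> x s (real n) \<partial>\<mu>)"
      using \<mu>_pos by (intro integral_cong_AE) (auto elim!: eventually_mono)
    then show ?thesis
      using expectation_osc[OF \<mu> _ char z_def] \<alpha> by simp
  qed
  \<comment> \<open>Since \<alpha> > 1, the angle \<open>pi / (2 * \<alpha>)\<close> lies strictly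
    between 0 and \<open>pi / 2\<close>, and the exponential decays.\<close>
  moreover have "Re z < 0"
  proof -
    have "cos (pi / (2 * \<alpha>)) > 0" using \<alpha> by (intro cos_gt_zero) (auto simp: field_simps)
    then show ?thesis using t by (simp add: z_def Re_exp)
  qed
  ultimately have "(\<lambda>n. integral\<^sup>L \<mu> (?g n)) \<longlonglongrightarrow> Re (- 1 / z)"
    using filterlim_compose[OF integral_Re_exp_tendsto filterlim_real_sequentially, of z] by simp
  with 2 have "integral\<^sup>L \<mu> ?f = Re (- 1 / z)" by (rule LIMSEQ_unique)
  with 1 show ?thesis
    unfolding Cauchy_kernel_eq[OF z_def] by (simp add: has_bochner_integral_iff)
qed

section \<open>Mixtures of two Cauchy densities and the subordinated density\<close>

lemma quadratic_sin_pos: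
  fixes x t :: real
  assumes "t > 0" "cos \<phi> \<noteq> 0"
  shows "x\<^sup>2 + t\<^sup>2 + 2 * x * t * sin \<phi> > 0" "x\<^sup>2 + t\<^sup>2 - 2 * x * t * sin \<phi> > 0"
proof -
  have "(t * cos \<phi>)\<^sup>2 > 0" using assms by simp
  moreover have "x\<^sup>2 + t\<^sup>2 + 2 * x * t * sin \<phi> = (x + t * sin \<phi>)\<^sup>2 + (t * cos \<phi>)\<^sup>2"
    "x\<^sup>2 + t\<^sup>2 - 2 * x * t * sin \<phi> = (x - t * sin \<phi>)\<^sup>2 + (t * cos \<phi>)\<^sup>2"
    using sin_cos_squared_add[of \<phi>] by algebra+
  ultimately show "x\<^sup>2 + t\<^sup>2 + 2 * x * t * sin \<phi> > 0" "x\<^sup>2 + t\<^sup>2 - 2 * x * t * sin \<phi> > 0"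
    by (auto intro: add_nonneg_pos)
qed

text \<open>The affine change \<open>u = (x + a) / c\<close> reduces the claim to the integral of
  \<open>1 / (1 + u^2)\<close>, which is \<pi>.\<close>

lemma has_bochner_integral_Cauchy_density:
  fixes a c :: real
  assumes "c > 0"
  shows "has_bochner_integral lborel (\<lambda>x. c / (pi * ((x + a)\<^sup>2 + c\<^sup>2))) 1"
proof -
  have e: "einterval (-\<infinity>) \<infinity> = UNIV" by (auto simp: einterval_def)
  have std: "has_bochner_integral lborel (\<lambda>x. inverse (1 + x\<^sup>2)) pi"
    using integrable_inverse_1_plus_square LBINT_inverse_1_plus_square
    unfolding has_bochner_integral_iff interval_lebesgue_integral_def set_integrable_def
      set_lebesgue_integral_def e by simp
  have "has_bochner_integral lborel (\<lambda>x. inverse (1 + (a / c + (1 / c) * x)\<^sup>2)) (pi /\<^sub>R \<bar>1 / c\<bar>)"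
    using assms lborel_has_bochner_integral_real_affine_iff[of "1 / c" "\<lambda>x. inverse (1 + x\<^sup>2)" pi "a / c"] std
    by simp
  then have "has_bochner_integral lborel (\<lambda>x. 1 / (pi * c) * inverse (1 + (a / c + (1 / c) * x)\<^sup>2))
      (1 / (pi * c) * (pi /\<^sub>R \<bar>1 / c\<bar>))"
    by (intro has_bochner_integral_mult_right)
  moreover have "1 / (pi * c) * inverse (1 + (a / c + (1 / c) * x)\<^sup>2) = c / (pi * ((x + a)\<^sup>2 + c\<^sup>2))" for x
  proof -
    have "(1 + (a / c + (1 / c) * x)\<^sup>2) = ((x + a)\<^sup>2 + c\<^sup>2) / c\<^sup>2"
      using assms by (simp add: field_simps power2_eq_square)
    then show ?thesis using assms by (simp add: power2_eq_square)
  qed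
  moreover have "1 / (pi * c) * (pi /\<^sub>R \<bar>1 / c\<bar>) = 1" using assms by simp
  ultimately show ?thesis by simp
qed

text \<open>Completing the squares exhibits \<open>f\<close> as a convex combination of two Cauchy
  densities with common scale \<open>t * cos \<phi>\<close> and centres
  \<open>t * sin \<phi>\<close> and \<open>- t * sin \<phi>\<close>.\<close>

lemma Cauchy_mixture_density:
  fixes p t \<phi> :: real
  assumes p: "0 \<le> p" "p \<le> 1" and t: "t > 0" and \<phi>: "cos \<phi> > 0"
    and f: "\<And>x. f x = t * cos \<phi> / pi * (p / (x\<^sup>2 + t\<^sup>2 - 2 * x * t * sin \<phi>)
      + (1 - p) / (x\<^sup>2 + t\<^sup>2 + 2 * x * t * sin \<phi>))"
  shows "f x \<ge> 0" "has_bochner_integral lborel f 1"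
proof -
  have "0 \<le> p / (x\<^sup>2 + t\<^sup>2 - 2 * x * t * sin \<phi>)" "0 \<le> (1 - p) / (x\<^sup>2 + t\<^sup>2 + 2 * x * t * sin \<phi>)"
    using p quadratic_sin_pos[OF t, of \<phi> x] \<phi> by simp_all
  then show "f x \<ge> 0"
    unfolding f using t \<phi> by simp
  let ?C = "\<lambda>a x. t * cos \<phi> / (pi * ((x + a)\<^sup>2 + (t * cos \<phi>)\<^sup>2))"
  have "f = (\<lambda>x. p * ?C (- (t * sin \<phi>)) x + (1 - p) * ?C (t * sin \<phi>) x)"
  proof
    fix x
    have D: "(x + - (t * sin \<phi>))\<^sup>2 + (t * cos \<phi>)\<^sup>2 = x\<^sup>2 + t\<^sup>2 - 2 * x * t * sin \<phi>"
      "(x + t * sin \<phi>)\<^sup>2 + (t * cos \<phi>)\<^sup>2 = x\<^sup>2 + t\<^sup>2 + 2 * x * t * sin \<phi>"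
      using sin_cos_squared_add[of \<phi>] by algebra+
    then show "f x = p * ?C (- (t * sin \<phi>)) x + (1 - p) * ?C (t * sin \<phi>) x"
      unfolding f D by (simp add: distrib_left mult_ac)
  qed
  moreover have "has_bochner_integral lborel
      (\<lambda>x. p * ?C (- (t * sin \<phi>)) x + (1 - p) * ?C (t * sin \<phi>) x) (p * 1 + (1 - p) * 1)"
    using t \<phi> by (intro has_bochner_integral_add has_bochner_integral_mult_right
        has_bochner_integral_Cauchy_density) auto
  ultimately show "has_bochner_integral lborel f 1" by simp
qed

lemma Fresnel_expectation:
  fixes M :: "'w measure"
  assumes S: "stable_subordinator_at M (1 / \<alpha>) t S" and h: "halfline_density M S h"
    and \<alpha>: "\<alpha> > 1" and t: "t > 0"
  shows "set_integrable lborel {0<..} (\<lambda>s. Fresnel_density \<alpha> p x s * h s)" (is ?thesis1)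
    and "subordinated_density (Fresnel_density \<alpha> p) h x = t * cos (pi / (2 * \<alpha>)) / pi *
          (p / (x\<^sup>2 + t\<^sup>2 - 2 * x * t * sin (pi / (2 * \<alpha>)))
           + (1 - p) / (x\<^sup>2 + t\<^sup>2 + 2 * x * t * sin (pi / (2 * \<alpha>))))" (is "_ = ?v")
proof -
  have M: "prob_space M" and [measurable]: "S \<in> borel_measurable M" and S_pos: "AE w in M. 0 < S w"
    and char: "\<And>\<gamma>. char (distr M borel S) \<gamma> =
      exp (- of_real (t * \<bar>\<gamma>\<bar> powr (1 / \<alpha>)) * exp (- \<i> * of_real (pi * (1 / \<alpha>) / 2 * sgn \<gamma>)))"
    using S unfolding stable_subordinator_at_def by blast+
  interpret prob_space M by fact
  have \<mu>: "real_distribution (distr M borel S)" by (rule real_distribution_distr) simp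
  have \<mu>_pos: "AE s in distr M borel S. 0 < s" using S_pos by (subst AE_distr_iff) auto
  have h_nonneg: "0 \<le> h s * indicator {0<..} s" for s
    using h unfolding halfline_density_def by (auto simp: indicator_def)
  \<comment> \<open>With the indicator inside \<open>ennreal\<close> the density is the image of a
    nonnegative real function on the whole line, the form in which expectations are transferred
    below.\<close>
  have "(\<lambda>s. ennreal (h s * indicator {0<..} s)) = (\<lambda>s. ennreal (h s) * indicator {0<..} s)"
    by (auto simp: indicator_def)
  then have dist: "distributed M lborel S (\<lambda>s. ennreal (h s * indicator {0<..} s))"
    using h unfolding halfline_density_def by simp
  define F where "F y s = indicator {0<..} s * osc_limit \<alpha> y s" for y s
  define G where "G s = p / pi * F (- x) s + (1 - p) / pi * F x s" for s
  have "has_bochner_integral (distr M borel S) G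
    (p / pi * (t * cos (pi / (2 * \<alpha>)) / ((- x)\<^sup>2 + t\<^sup>2 + 2 * (- x) * t * sin (pi / (2 * \<alpha>))))
     + (1 - p) / pi * (t * cos (pi / (2 * \<alpha>)) / (x\<^sup>2 + t\<^sup>2 + 2 * x * t * sin (pi / (2 * \<alpha>)))))"
    unfolding G_def F_def
    by (intro has_bochner_integral_add has_bochner_integral_mult_right
        osc_limit_expectation[OF \<mu> \<mu>_pos \<alpha> t char])
  also have "(p / pi * (t * cos (pi / (2 * \<alpha>)) / ((- x)\<^sup>2 + t\<^sup>2 + 2 * (- x) * t * sin (pi / (2 * \<alpha>))))
     + (1 - p) / pi * (t * cos (pi / (2 * \<alpha>)) / (x\<^sup>2 + t\<^sup>2 + 2 * x * t * sin (pi / (2 * \<alpha>))))) = ?v"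
    by (simp add: algebra_simps)
  finally have G: "has_bochner_integral (distr M borel S) G ?v" .
  then have [measurable]: "G \<in> borel_measurable borel"
    using borel_measurable_has_bochner_integral by fastforce
  have G': "has_bochner_integral M (\<lambda>w. G (S w)) ?v"
    using G by (simp add: has_bochner_integral_iff integrable_distr_eq integral_distr)
  \<comment> \<open>On the half-line this is the expression of the Fresnel density through
    \<open>osc_limit\<close>; elsewhere both sides are 0, whatever \<open>h\<close> is
    there.\<close>
  have eq: "indicator {0<..} s *\<^sub>R (Fresnel_density \<alpha> p x s * h s) = h s * indicator {0<..} s * G s" for s
    using Fresnel_density_eq_osc_limit[OF \<alpha>, of s p x]
    by (auto simp: indicator_def G_def F_def)
  show ?thesis1
    unfolding set_integrable_def eq
    using distributed_integrable[OF dist _ h_nonneg, of G] G' by (simp add: has_bochner_integral_iff)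
  show "subordinated_density (Fresnel_density \<alpha> p) h x = ?v"
    unfolding subordinated_density_def set_lebesgue_integral_def eq
    using distributed_integral[OF dist _ h_nonneg, of G] G' by (simp add: has_bochner_integral_iff)
qed

text \<open>The product of the denominators is
  \<open>(x^2 + t^2)^2 - 4 * x^2 * t^2 * (sin \<phi>)^2\<close>, and the double angle formula
  absorbs the squared sine.\<close>

lemma Cauchy_mixture_common_denominator:
  fixes p t \<phi> :: real
  assumes t: "t > 0" and \<phi>: "cos \<phi> \<noteq> 0"
  shows "p / (x\<^sup>2 + t\<^sup>2 - 2 * x * t * sin \<phi>) + (1 - p) / (x\<^sup>2 + t\<^sup>2 + 2 * x * t * sin \<phi>)
    = (x\<^sup>2 + t\<^sup>2 + 2 * (2 * p - 1) * x * t * sin \<phi>) / (x ^ 4 + t ^ 4 + 2 * x\<^sup>2 * t\<^sup>2 * cos (2 * \<phi>))"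
proof -
  have "cos (2 * \<phi>) = 1 - 2 * (sin \<phi>)\<^sup>2" by (rule cos_double_sin)
  then have den: "x ^ 4 + t ^ 4 + 2 * x\<^sup>2 * t\<^sup>2 * cos (2 * \<phi>)
    = (x\<^sup>2 + t\<^sup>2 - 2 * x * t * sin \<phi>) * (x\<^sup>2 + t\<^sup>2 + 2 * x * t * sin \<phi>)"
    by algebra
  have num: "x\<^sup>2 + t\<^sup>2 + 2 * (2 * p - 1) * x * t * sin \<phi>
    = p * (x\<^sup>2 + t\<^sup>2 + 2 * x * t * sin \<phi>) + (1 - p) * (x\<^sup>2 + t\<^sup>2 - 2 * x * t * sin \<phi>)"
    by algebra
  show ?thesis
    unfolding den num using quadratic_sin_pos[OF t \<phi>, of x]
    by (subst add_frac_eq) (auto simp: mult_ac)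
qed

section \<open>Stationary points for the special parameters\<close>

text \<open>For the special parameters, \<open>f\<close> in the variable \<open>y = \<sigma> * sqrt 3 * x / t\<close> is a constant multiple of
  the following function, whose derivative has a double zero at \<open>1\<close>.\<close>

definition profile :: "real \<Rightarrow> real" where
  "profile y = (y\<^sup>2 - 2 * y + 3) / (y ^ 4 - 2 * y\<^sup>2 + 9)"

text \<open>The cofactor of \<open>- 2 * (y - 1)^2\<close> in the numerator of the derivative of
  \<open>profile\<close>.\<close>

definition profile_cubic :: "real \<Rightarrow> real" where
  "profile_cubic y = y ^ 3 - y\<^sup>2 + 3 * y + 9"

definition profile' :: "real \<Rightarrow> real" where
  "profile' y = - 2 * (y - 1)\<^sup>2 * profile_cubic y / (y ^ 4 - 2 * y\<^sup>2 + 9)\<^sup>2"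

lemma profile_denominator_pos: "y ^ 4 - 2 * y\<^sup>2 + 9 > (0 :: real)"
proof -
  have "y ^ 4 - 2 * y\<^sup>2 + 9 = (y\<^sup>2 - 1)\<^sup>2 + 8" by algebra
  then show ?thesis using zero_le_power2[of "y\<^sup>2 - 1"] by linarith
qed

lemma profile_deriv: "(profile has_real_derivative profile' y) (at y)"
proof -
  have nz: "y ^ 4 - 2 * y\<^sup>2 + 9 \<noteq> 0" using profile_denominator_pos[of y] by simp
  have "(profile has_real_derivative
      ((2 * y - 2) * (y ^ 4 - 2 * y\<^sup>2 + 9) - (y\<^sup>2 - 2 * y + 3) * (4 * y ^ 3 - 4 * y))
        / ((y ^ 4 - 2 * y\<^sup>2 + 9) * (y ^ 4 - 2 * y\<^sup>2 + 9))) (at y)"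
    unfolding profile_def
    by (rule DERIV_divide) (auto intro!: derivative_eq_intros simp: nz)
  moreover have "(2 * y - 2) * (y ^ 4 - 2 * y\<^sup>2 + 9) - (y\<^sup>2 - 2 * y + 3) * (4 * y ^ 3 - 4 * y)
      = - 2 * (y - 1)\<^sup>2 * profile_cubic y"
    unfolding profile_cubic_def by algebra
  ultimately show ?thesis by (simp add: profile'_def power2_eq_square[of "y ^ 4 - 2 * y\<^sup>2 + 9"])
qed

text \<open>The divided difference is \<open>u^2 + u * v + v^2 - u - v + 3\<close>; completing the
  square first in \<open>u\<close>, then in \<open>v\<close>, leaves the constant
  \<open>8 / 3\<close>.\<close>

lemma profile_cubic_strict_mono:
  assumes "u < v"
  shows "profile_cubic u < profile_cubic v"
proof -
  have "profile_cubic v - profile_cubic u = (v - u) * ((u + v / 2 - 1 / 2)\<^sup>2 + (3 / 4) * (v - 1 / 3)\<^sup>2 + 8 / 3)"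
    unfolding profile_cubic_def by (simp add: power2_eq_square power3_eq_cube field_simps)
  also have "\<dots> > 0"
    using assms by (intro mult_pos_pos add_nonneg_pos) auto
  finally show ?thesis by simp
qed

text \<open>The derivative of \<open>profile\<close> vanishes at 1 and at the only root
  \<open>y0\<close> of the increasing cubic. Its sign is opposite to that of the cubic, so
  \<open>profile\<close> rises up to \<open>y0\<close> and falls afterwards, with a mere pause at
  the double zero 1.\<close>

lemma stationary_points_rescaled_profile:
  assumes C: "C > 0" and k: "k \<noteq> 0" and f: "\<And>x. f x = C * profile (k * x)"
  obtains m where "m \<noteq> 1 / k" "{x. stationary_point f x} = {1 / k, m}"
    "stationary_inflection_point f (1 / k)" "\<And>x. f x \<le> f m"
proof -
  \<comment> \<open>The cubic is -9 at -2 and 4 at -1; this also keeps the root away from 1.\<close>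
  have "\<exists>y\<ge>-2. y \<le> -1 \<and> profile_cubic y = 0"
    by (rule IVT) (auto simp: profile_cubic_def intro!: continuous_intros)
  then obtain y0 where y0: "y0 \<le> -1" "profile_cubic y0 = 0" by blast
  have f': "(f has_real_derivative C * k * profile' (k * x)) (at x)" for x
  proof -
    have "((\<lambda>x. C * profile (k * x)) has_real_derivative C * (profile' (k * x) * k)) (at x)"
      by (intro DERIV_cmult DERIV_chain2[OF profile_deriv]) (auto intro!: derivative_eq_intros)
    moreover have "f = (\<lambda>x. C * profile (k * x))" using f by (rule ext)
    ultimately show ?thesis by (simp add: mult_ac)
  qed
  then have deriv_f: "deriv f = (\<lambda>x. C * k * profile' (k * x))"
    by (auto intro!: DERIV_imp_deriv)
  have stat: "stationary_point f x \<longleftrightarrow> x = 1 / k \<or> x = y0 / k" for x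
  proof -
    have "stationary_point f x \<longleftrightarrow> C * k * profile' (k * x) = 0"
      unfolding stationary_point_def using f'[of x] DERIV_unique by metis
    also have "\<dots> \<longleftrightarrow> k * x = 1 \<or> profile_cubic (k * x) = 0"
      using C k profile_denominator_pos[of "k * x"] by (auto simp: profile'_def)
    also have "profile_cubic (k * x) = 0 \<longleftrightarrow> k * x = y0"
      using y0 profile_cubic_strict_mono[of "k * x" y0] profile_cubic_strict_mono[of y0 "k * x"]
      by (cases "k * x" y0 rule: linorder_cases) auto
    finally show ?thesis using k by (auto simp: field_simps)
  qed
  have max: "profile y \<le> profile y0" for y
  proof (cases "y \<le> y0")
    case True
    then show ?thesis
    proof (rule DERIV_nonneg_imp_nondecreasing)
      fix u assume "y \<le> u" "u \<le> y0"
      then have "profile_cubic u \<le> 0"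
        using y0 profile_cubic_strict_mono[of u y0] by (cases "u = y0") auto
      then have "profile' u \<ge> 0"
        unfolding profile'_def by (intro divide_nonneg_nonneg mult_nonpos_nonpos) auto
      then show "\<exists>D. (profile has_real_derivative D) (at u) \<and> 0 \<le> D"
        using profile_deriv by blast
    qed
  next
    case False
    then have "y0 \<le> y" by simp
    then show ?thesis
    proof (rule DERIV_nonpos_imp_nonincreasing)
      fix u assume "y0 \<le> u" "u \<le> y"
      then have "profile_cubic u \<ge> 0"
        using y0 profile_cubic_strict_mono[of y0 u] by (cases "u = y0") auto
      then have "profile' u \<le> 0"
        unfolding profile'_def by (intro divide_nonpos_nonneg mult_nonpos_nonneg) auto
      then show "\<exists>D. (profile has_real_derivative D) (at u) \<and> D \<le> 0"
        using profile_deriv by blast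
    qed
  qed
  have "stationary_inflection_point f (1 / k)"
    unfolding stationary_inflection_point_def
  proof (intro conjI)
    show "stationary_point f (1 / k)" using stat by simp
    show "\<forall>\<^sub>F y in nhds (1 / k). f differentiable (at y)"
      using f' by (intro always_eventually) (auto simp: real_differentiable_def)
    \<comment> \<open>The double factor \<open>(y - 1)^2\<close> kills the derivative of
      \<open>profile'\<close> at 1.\<close>
    have "(profile' has_real_derivative 0) (at 1)"
      unfolding profile'_def[abs_def] profile_cubic_def
      by (auto intro!: derivative_eq_intros)
    then have "((\<lambda>x. C * k * profile' (k * x)) has_real_derivative C * k * (0 * k)) (at (1 / k))"
      using k by (intro DERIV_cmult DERIV_chain2[of profile' 0 "\<lambda>x. k * x"]) (auto intro!: derivative_eq_intros)
    then show "(deriv f has_real_derivative 0) (at (1 / k))" unfolding deriv_f by simp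
    \<comment> \<open>The cubic equals 12 at 1, so near that point it stays positive and
      \<open>profile'\<close> stays nonpositive on both sides.\<close>
    have "((\<lambda>x. profile_cubic (k * x)) \<longlongrightarrow> profile_cubic (k * (1 / k))) (at (1 / k))"
      unfolding profile_cubic_def by (intro tendsto_intros)
    moreover have "profile_cubic (k * (1 / k)) > 0" using k by (simp add: profile_cubic_def)
    ultimately have "\<forall>\<^sub>F x in at (1 / k). profile_cubic (k * x) > 0" by (rule order_tendstoD)
    then have nonpos: "\<forall>\<^sub>F x in at (1 / k). profile' (k * x) \<le> 0"
      unfolding profile'_def
      by (rule eventually_mono) (intro divide_nonpos_nonneg mult_nonpos_nonneg, auto)
    \<comment> \<open>A negative \<open>k\<close> reflects the graph and flips the sign of the
      derivative, which remains constant around the point.\<close>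
    show "(\<forall>\<^sub>F y in at (1 / k). 0 \<le> deriv f y) \<or> (\<forall>\<^sub>F y in at (1 / k). deriv f y \<le> 0)"
    proof (cases "k > 0")
      case True
      then have "\<forall>\<^sub>F y in at (1 / k). deriv f y \<le> 0"
        unfolding deriv_f using nonpos C by (auto elim!: eventually_mono intro: mult_nonneg_nonpos)
      then show ?thesis ..
    next
      case False
      then have "\<forall>\<^sub>F y in at (1 / k). 0 \<le> deriv f y"
        unfolding deriv_f using nonpos C
        by (auto elim!: eventually_mono intro!: mult_nonpos_nonpos mult_nonneg_nonpos)
      then show ?thesis ..
    qed
  qed
  moreover have "y0 / k \<noteq> 1 / k" using y0 k by auto
  moreover have "{x. stationary_point f x} = {1 / k, y0 / k}" using stat by auto
  moreover have "f x \<le> f (y0 / k)" for x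
    using max[of "k * x"] C k by (simp add: f)
  ultimately show ?thesis using that by blast
qed

text \<open>The angle gives \<open>cos (2 * \<phi>) = - 1 / 3\<close>, and \<open>p\<close> is tuned
  so that \<open>(2 * p - 1) * sin \<phi> = - \<sigma> / sqrt 3\<close>. In the variable
  \<open>y\<close>, the powers of \<open>t\<close> then factor out of numerator and denominator, and
  \<sigma> disappears through \<open>\<sigma>\<^sup>2 = 1\<close>.\<close>

lemma mixture_eq_rescaled_profile:
  fixes x t \<sigma> :: real
  assumes t: "t > 0" and \<sigma>: "\<sigma> \<in> {1, -1}"
    and p: "p = (sqrt 2 - \<sigma>) / (2 * sqrt 2)" and \<phi>: "\<phi> = arccos (1 / sqrt 3)"
  shows "(x\<^sup>2 + t\<^sup>2 + 2 * (2 * p - 1) * x * t * sin \<phi>) / (x ^ 4 + t ^ 4 + 2 * x\<^sup>2 * t\<^sup>2 * cos (2 * \<phi>))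
    = 3 / t\<^sup>2 * profile (\<sigma> * sqrt 3 / t * x)"
proof -
  define y where "y = \<sigma> * sqrt 3 / t * x"
  have \<sigma>2: "\<sigma>\<^sup>2 = 1" using \<sigma> by auto
  have s3: "- 1 < 1 / sqrt 3" "1 / sqrt 3 < 1"
    by (auto intro: less_trans[of "- 1" 0 "1 / sqrt 3"])
  have cos: "cos \<phi> = 1 / sqrt 3"
    unfolding \<phi> by (rule cos_arccos) (use s3 in linarith)+
  have "sin \<phi> = sqrt (1 - (1 / sqrt 3)\<^sup>2)"
    unfolding \<phi> by (rule sin_arccos) (use s3 in linarith)+
  also have "\<dots> = sqrt 2 / sqrt 3" by (simp add: power_divide real_sqrt_divide[symmetric])
  finally have sin: "sin \<phi> = sqrt 2 / sqrt 3" .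
  have cos2: "cos (2 * \<phi>) = - 1 / 3"
    unfolding cos_double_cos cos by (simp add: power_divide)
  have "2 * p - 1 = - \<sigma> / sqrt 2" unfolding p by (simp add: field_simps)
  then have lin: "(2 * p - 1) * sin \<phi> = - \<sigma> / sqrt 3" unfolding sin by simp
  have x: "x = \<sigma> * t * y / sqrt 3"
    using t \<sigma>2 by (simp add: y_def power2_eq_square)
  have x2: "x\<^sup>2 = t\<^sup>2 * y\<^sup>2 / 3"
    unfolding x using \<sigma>2 by (simp add: power_mult_distrib power_divide)
  have x4: "x ^ 4 = t ^ 4 * y ^ 4 / 9"
  proof -
    have "x ^ 4 = (x\<^sup>2)\<^sup>2" by simp
    then show ?thesis unfolding x2 by (simp add: power_divide power_mult_distrib flip: power_mult)
  qed
  have "2 * (2 * p - 1) * x * t * sin \<phi> = 2 * ((2 * p - 1) * sin \<phi>) * x * t" by simp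
  also have "\<dots> = - 2 * t\<^sup>2 * y / 3"
    unfolding lin unfolding x using \<sigma>2 by (simp add: power2_eq_square)
  finally have num: "x\<^sup>2 + t\<^sup>2 + 2 * (2 * p - 1) * x * t * sin \<phi> = t\<^sup>2 / 3 * (y\<^sup>2 - 2 * y + 3)"
    using x2 by (simp add: field_simps)
  have den: "x ^ 4 + t ^ 4 + 2 * x\<^sup>2 * t\<^sup>2 * cos (2 * \<phi>) = t ^ 4 / 9 * (y ^ 4 - 2 * y\<^sup>2 + 9)"
    unfolding x2 x4 cos2 by (simp add: field_simps power2_eq_square power4_eq_xxxx)
  have "t\<^sup>2 / 3 / (t ^ 4 / 9) = 3 / t\<^sup>2"
    using t by (simp add: field_simps power2_eq_square power4_eq_xxxx)
  then show ?thesis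
    by (simp only: num den y_def[symmetric] profile_def times_divide_times_eq[symmetric])
qed

section \<open>Assembly of the law, its quotient form and the stationary points\<close>

theorem mainTheorem11:
  fixes \<alpha> p t :: real and f :: "real \<Rightarrow> real"
  assumes "\<alpha> > 1" and "0 \<le> p" and "p \<le> 1" and "t > 0"
    and f_def: "\<And>x. f x = t * cos (pi / (2 * \<alpha>)) / pi *
          (p / (x^2 + t^2 - 2 * x * t * sin (pi / (2 * \<alpha>)))
           + (1 - p) / (x^2 + t^2 + 2 * x * t * sin (pi / (2 * \<alpha>))))"
  shows
    "(\<forall>(M :: 'w measure) S h.
        stable_subordinator_at M (1 / \<alpha>) t S \<and> halfline_density M S h \<longrightarrow>
        (\<forall>x. set_integrable lborel {0<..} (\<lambda>s. Fresnel_density \<alpha> p x s * h s)) \<and>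
        integrable lborel (subordinated_density (Fresnel_density \<alpha> p) h) \<and>
        has_probability_density
          (signed_measure_of_density (subordinated_density (Fresnel_density \<alpha> p) h)) f)
     \<and> (\<forall>x. f x = t * cos (pi / (2 * \<alpha>)) / pi *
          ((x^2 + t^2 + 2 * (2 * p - 1) * x * t * sin (pi / (2 * \<alpha>)))
           / (x^4 + t^4 + 2 * x^2 * t^2 * cos (pi / \<alpha>))))
     \<and> (\<forall>\<sigma>\<in>{1, -1}.
          \<alpha> = pi / (2 * arccos (1 / sqrt 3)) \<and> p = (sqrt 2 - \<sigma>) / (2 * sqrt 2) \<longrightarrow>
          (\<exists>m. m \<noteq> \<sigma> * t / sqrt 3 \<and>
               {x. stationary_point f x} = {\<sigma> * t / sqrt 3, m} \<and>
               stationary_inflection_point f (\<sigma> * t / sqrt 3) \<and>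
               (\<forall>x. f x \<le> f m)))"
proof (intro conjI)
  define \<phi> where "\<phi> = pi / (2 * \<alpha>)"
  have cos_pos: "cos \<phi> > 0"
    unfolding \<phi>_def using \<open>\<alpha> > 1\<close> by (intro cos_gt_zero) (auto simp: field_simps)
  have f_eq: "f x = t * cos \<phi> / pi * (p / (x^2 + t^2 - 2 * x * t * sin \<phi>)
      + (1 - p) / (x^2 + t^2 + 2 * x * t * sin \<phi>))" for x
    unfolding f_def \<phi>_def ..
  show "\<forall>(M :: 'w measure) S h.
        stable_subordinator_at M (1 / \<alpha>) t S \<and> halfline_density M S h \<longrightarrow>
        (\<forall>x. set_integrable lborel {0<..} (\<lambda>s. Fresnel_density \<alpha> p x s * h s)) \<and>
        integrable lborel (subordinated_density (Fresnel_density \<alpha> p) h) \<and>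
        has_probability_density
          (signed_measure_of_density (subordinated_density (Fresnel_density \<alpha> p) h)) f"
  proof (intro allI impI)
    fix M :: "'w measure" and S h
    assume *: "stable_subordinator_at M (1 / \<alpha>) t S \<and> halfline_density M S h"
    \<comment> \<open>The subordinated density agrees with \<open>f\<close> at every point, not just
      almost everywhere, so the remaining claims concern the Cauchy mixture alone.\<close>
    have eq: "subordinated_density (Fresnel_density \<alpha> p) h = f"
    proof
      fix x
      show "subordinated_density (Fresnel_density \<alpha> p) h x = f x"
        using Fresnel_expectation(2)[of M \<alpha> t S h p x] * \<open>\<alpha> > 1\<close> \<open>t > 0\<close>
        unfolding f_def by simp
    qed
    note density = Cauchy_mixture_density[OF \<open>0 \<le> p\<close> \<open>p \<le> 1\<close> \<open>t > 0\<close> cos_pos f_eq]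
    show "(\<forall>x. set_integrable lborel {0<..} (\<lambda>s. Fresnel_density \<alpha> p x s * h s)) \<and>
        integrable lborel (subordinated_density (Fresnel_density \<alpha> p) h) \<and>
        has_probability_density
          (signed_measure_of_density (subordinated_density (Fresnel_density \<alpha> p) h)) f"
      unfolding eq has_probability_density_def signed_measure_of_density_def
    proof (intro conjI allI ballI refl density)
      show "set_integrable lborel {0<..} (\<lambda>s. Fresnel_density \<alpha> p x s * h s)" for x
        using Fresnel_expectation(1)[of M \<alpha> t S h p x] * \<open>\<alpha> > 1\<close> \<open>t > 0\<close> by simp
      show "integrable lborel f" using density(2) by (simp add: has_bochner_integral_iff)
    qed
  qed
  have quotient: "f x = t * cos \<phi> / pi * ((x^2 + t^2 + 2 * (2 * p - 1) * x * t * sin \<phi>)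
      / (x^4 + t^4 + 2 * x^2 * t^2 * cos (2 * \<phi>)))" for x
    unfolding f_eq using Cauchy_mixture_common_denominator[of t \<phi> p x] cos_pos \<open>t > 0\<close> by simp
  then show "\<forall>x. f x = t * cos (pi / (2 * \<alpha>)) / pi *
          ((x^2 + t^2 + 2 * (2 * p - 1) * x * t * sin (pi / (2 * \<alpha>)))
           / (x^4 + t^4 + 2 * x^2 * t^2 * cos (pi / \<alpha>)))"
    by (simp add: \<phi>_def)
  show "\<forall>\<sigma>\<in>{1, -1}.
          \<alpha> = pi / (2 * arccos (1 / sqrt 3)) \<and> p = (sqrt 2 - \<sigma>) / (2 * sqrt 2) \<longrightarrow>
          (\<exists>m. m \<noteq> \<sigma> * t / sqrt 3 \<and>
               {x. stationary_point f x} = {\<sigma> * t / sqrt 3, m} \<and>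
               stationary_inflection_point f (\<sigma> * t / sqrt 3) \<and>
               (\<forall>x. f x \<le> f m))"
  proof (intro ballI impI)
    fix \<sigma> :: real
    assume \<sigma>: "\<sigma> \<in> {1, -1}"
      and *: "\<alpha> = pi / (2 * arccos (1 / sqrt 3)) \<and> p = (sqrt 2 - \<sigma>) / (2 * sqrt 2)"
    have \<phi>: "\<phi> = arccos (1 / sqrt 3)" using * by (simp add: \<phi>_def)
    have f_profile: "f x = t * cos \<phi> / pi * (3 / t\<^sup>2) * profile (\<sigma> * sqrt 3 / t * x)" for x
      unfolding quotient using mixture_eq_rescaled_profile[OF \<open>t > 0\<close> \<sigma> _ \<phi>] * by simp
    have C: "t * cos \<phi> / pi * (3 / t\<^sup>2) > 0" using \<open>t > 0\<close> cos_pos by simp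
    have k: "\<sigma> * sqrt 3 / t \<noteq> 0" using \<open>t > 0\<close> \<sigma> by auto
    \<comment> \<open>As \<sigma> is its own inverse, the double zero \<open>y = 1\<close> sits at
      \<open>\<sigma> * t / sqrt 3\<close>, with the upper signs for
      \<open>\<sigma> = 1\<close>.\<close>
    have inv: "1 / (\<sigma> * sqrt 3 / t) = \<sigma> * t / sqrt 3" using \<sigma> by auto
    obtain m where "m \<noteq> \<sigma> * t / sqrt 3" "{x. stationary_point f x} = {\<sigma> * t / sqrt 3, m}"
      "stationary_inflection_point f (\<sigma> * t / sqrt 3)" "\<And>x. f x \<le> f m"
      by (rule stationary_points_rescaled_profile[OF C k f_profile, unfolded inv]) (rule that)
    then show "\<exists>m. m \<noteq> \<sigma> * t / sqrt 3 \<and>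
               {x. stationary_point f x} = {\<sigma> * t / sqrt 3, m} \<and>
               stationary_inflection_point f (\<sigma> * t / sqrt 3) \<and>
               (\<forall>x. f x \<le> f m)"
      by blast
  qed
qed

end
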